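(* Let $\alpha$ be a closed, regular, smooth plane curve of length $l$, parametrized by arc length $s\in\mathbb{S}^1=\mathbb{R}/l\mathbb{Z}$, with curvature $k(s)>0$ for all $s$, and let $F(s,\rho)=\alpha(s)+\rho\,n(s)$ be its normal map, regarded as a vector field on the cylinder $\mathbb{S}^1\times\mathbb{R}$. Suppose $\alpha$ is in generic position, meaning that its evolute $\beta(s)=\alpha(s)+\frac{1}{k(s)}n(s)$ does not pass through the origin of $\mathbb{R}^2$. Then every finite critical point of this vector field has Poincaré index $+1$ (called a centre) or $-1$ (called a saddle). Every saddle $(s^*,\rho^* )$ lies above the curve $\rho=1/k$, i.e. $\rho^*>1/k(s^* )$, and every centre $(s^*,\rho^* )$ lies below it, i.e. $\rho^*<1/k(s^* )$. There are as many saddles as there are centres (so the sum of the Poincaré indices of the finite critical points is zero), and there is at least one of each.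
   Context: The unit tangent is $t=\dot\alpha$ and $n$ is the unit normal such that $(t,n)$ is right-handed; the curvature $k$ is defined by $\dot t=k n$ (equivalently $\dot n=-kt$). The curve may have self-intersections. The normal map is $F:\mathbb{S}^1\times\mathbb{R}\to\mathbb{R}^2$, $F(s,\rho)=\alpha(s)+\rho\,n(s)$. It is regarded as a vector field on the cylinder $\mathbb{S}^1\times\mathbb{R}$ by taking the two Cartesian components of $F(s,\rho)=(F_1,F_2)$ as the components along the coordinate directions $\hat s$ and $\hat\rho$, i.e. the vector field $F_1\partial_s+F_2\partial_\rho$. A finite critical point is a point $(s^*,\rho^* )\in\mathbb{S}^1\times\mathbb{R}$ with $F(s^*,\rho^* )=0$. The Poincaré index of an isolated critical point is the degree of the map $F/|F|$ restricted to a small simple closed positively oriented curve (with respect to the orientation given by the coordinates $(s,\rho)$) that encloses this critical point and no other critical point. *)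

theory Defs
  imports "HOL-Complex_Analysis.Complex_Analysis"
begin

text \<open>
  The Euclidean plane is the type \<^typ>\<open>complex\<close>. Functions on the circle of length \<open>l\<close> are
  \<open>l\<close>-periodic functions on the real line.
\<close>

definition smooth_curve :: "(real \<Rightarrow> complex) \<Rightarrow> bool" where
  "smooth_curve \<alpha> \<longleftrightarrow>
     (\<forall>m s. ((\<lambda>f s. vector_derivative f (at s)) ^^ m) \<alpha> differentiable at s)"

definition closed_arclength_curve :: "real \<Rightarrow> (real \<Rightarrow> complex) \<Rightarrow> bool" where
  "closed_arclength_curve l \<alpha> \<longleftrightarrow>
     0 < l \<and> smooth_curve \<alpha> \<and> (\<forall>s. \<alpha> (s + l) = \<alpha> s) \<and>
     (\<forall>s. norm (vector_derivative \<alpha> (at s)) = 1)"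

definition unit_tangent :: "(real \<Rightarrow> complex) \<Rightarrow> real \<Rightarrow> complex" where
  "unit_tangent \<alpha> s = vector_derivative \<alpha> (at s)"

text \<open>Multiplication by \<^term>\<open>\<i>\<close> is the rotation by a positive right angle.\<close>

definition unit_normal :: "(real \<Rightarrow> complex) \<Rightarrow> real \<Rightarrow> complex" where
  "unit_normal \<alpha> s = \<i> * unit_tangent \<alpha> s"

definition curvature :: "(real \<Rightarrow> complex) \<Rightarrow> real \<Rightarrow> real" where
  "curvature \<alpha> s =
     (THE k. vector_derivative (unit_tangent \<alpha>) (at s) = k *\<^sub>R unit_normal \<alpha> s)"

definition evolute :: "(real \<Rightarrow> complex) \<Rightarrow> real \<Rightarrow> complex" where
  "evolute \<alpha> s = \<alpha> s + (1 / curvature \<alpha> s) *\<^sub>R unit_normal \<alpha> s"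

definition normal_map :: "(real \<Rightarrow> complex) \<Rightarrow> real \<times> real \<Rightarrow> complex" where
  "normal_map \<alpha> = (\<lambda>(s, \<rho>). \<alpha> s + \<rho> *\<^sub>R unit_normal \<alpha> s)"

text \<open>
  The normal map as a vector field, lifted to the universal cover of the cylinder. The
  point with coordinates \<open>(s, \<rho>)\<close> is the complex number \<open>s + \<i>\<rho>\<close>, so that the orientation given
  by \<open>(s, \<rho>)\<close> is the standard one; the real and imaginary parts of the value are the
  components along \<open>s\<close> and \<open>\<rho>\<close>.
\<close>

definition normal_field :: "(real \<Rightarrow> complex) \<Rightarrow> complex \<Rightarrow> complex" where
  "normal_field \<alpha> z = normal_map \<alpha> (Re z, Im z)"

definition isolated_critical_point :: "(complex \<Rightarrow> complex) \<Rightarrow> complex \<Rightarrow> bool" where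
  "isolated_critical_point V p \<longleftrightarrow> V p = 0 \<and> (\<forall>\<^sub>F z in at p. V z \<noteq> 0)"

definition positive_simple_loop :: "(real \<Rightarrow> complex) \<Rightarrow> bool" where
  "positive_simple_loop \<gamma> \<longleftrightarrow>
     simple_path \<gamma> \<and> pathfinish \<gamma> = pathstart \<gamma> \<and>
     (\<forall>z \<in> inside (path_image \<gamma>). winding_number \<gamma> z = 1)"

text \<open>
  The degree of \<open>V/|V|\<close> along a positively oriented simple loop \<open>\<gamma>\<close>, as a map into the unit
  circle, is the winding number about the origin of the loop \<open>V/|V| \<circ> \<gamma>\<close>. A loop within a
  sufficiently small disc of the universal cover is the same as a small loop on the cylinder.
\<close>

definition has_poincare_index :: "(complex \<Rightarrow> complex) \<Rightarrow> complex \<Rightarrow> int \<Rightarrow> bool" where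
  "has_poincare_index V p i \<longleftrightarrow>
     isolated_critical_point V p \<and>
     (\<exists>\<epsilon>>0. \<forall>\<gamma>. positive_simple_loop \<gamma> \<and> path_image \<gamma> \<subseteq> ball p \<epsilon> \<and>
        p \<in> inside (path_image \<gamma>) \<and>
        (\<forall>z \<in> path_image \<gamma> \<union> inside (path_image \<gamma>). V z = 0 \<longrightarrow> z = p) \<longrightarrow>
        winding_number (\<lambda>x. V (\<gamma> x) /\<^sub>R norm (V (\<gamma> x))) 0 = of_int i)"

definition poincare_index :: "(complex \<Rightarrow> complex) \<Rightarrow> complex \<Rightarrow> int" where
  "poincare_index V p = (THE i. has_poincare_index V p i)"

text \<open>
  Each point of the cylinder has exactly one representative \<open>(s, \<rho>)\<close> with \<open>0 \<le> s < l\<close>, so the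
  following sets count every critical point of the cylinder once.
\<close>

definition critical_points :: "real \<Rightarrow> (real \<Rightarrow> complex) \<Rightarrow> (real \<times> real) set" where
  "critical_points l \<alpha> = {(s, \<rho>). 0 \<le> s \<and> s < l \<and> normal_map \<alpha> (s, \<rho>) = 0}"

definition centres :: "real \<Rightarrow> (real \<Rightarrow> complex) \<Rightarrow> (real \<times> real) set" where
  "centres l \<alpha> =
     {(s, \<rho>) \<in> critical_points l \<alpha>. has_poincare_index (normal_field \<alpha>) (Complex s \<rho>) 1}"

definition saddles :: "real \<Rightarrow> (real \<Rightarrow> complex) \<Rightarrow> (real \<times> real) set" where
  "saddles l \<alpha> =
     {(s, \<rho>) \<in> critical_points l \<alpha>. has_poincare_index (normal_field \<alpha>) (Complex s \<rho>) (-1)}"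

end

theory Submission
  imports Defs
begin

text \<open>
  A zero of the normal map is a pair \<open>(s, \<rho>)\<close> with \<open>\<alpha>(s) = - \<rho> n(s)\<close>. Such a \<open>\<rho>\<close> exists, and is
  then unique, exactly when the tangential part \<open>h = \<alpha> \<bullet> t\<close> vanishes at \<open>s\<close>. So the critical
  points are governed by the zeros of one periodic real function, and everything follows from
  the fact that its derivative at a zero is the Jacobian of the normal map there.

  By the Frenet equations the derivative of the normal map at any \<open>(s, \<rho>)\<close> sends \<open>\<partial>\<^sub>s\<close> to
  \<open>(1 - \<rho>k) t\<close> and \<open>\<partial>\<^sub>\<rho>\<close> to \<open>n = \<i>t\<close>; its determinant is \<open>1 - \<rho>k\<close>. On the other hand
  \<open>h' = 1 + k (\<alpha> \<bullet> n)\<close>, and \<open>\<alpha> \<bullet> n = - \<rho>\<close> at a critical point, so \<open>h' = 1 - \<rho>k\<close> there. If this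
  number were zero, the evolute would pass through the origin. Hence all critical points are
  nondegenerate, and their index is the sign of \<open>1 - \<rho>k\<close>
  (\<open>has_poincare_index_nondegenerate\<close>). For \<open>k > 0\<close> this sign says on which side of the curve
  \<open>\<rho> = 1/k\<close> the point lies.

  It remains to count. A function with simple zeros changes sign at each of them, alternately
  upwards and downwards, so over a full period the signs of \<open>h'\<close> at the zeros cancel
  (\<open>sum_sgn_simple_zeros\<close>): there are as many saddles as centres. Finally \<open>2h\<close> is the
  derivative of the periodic function \<open>|\<alpha>|\<^sup>2\<close>, so \<open>h\<close> has a zero by Rolle's theorem, and then
  both signs occur.
\<close>

section \<open>Winding numbers of loops around the origin\<close>

text \<open>
  The loop \<open>\<gamma>\<close> is turned and stretched into \<open>u \<gamma>\<close> by the factors \<open>exp (\<tau> Ln u)\<close>, \<open>0 \<le> \<tau> \<le> 1\<close>,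
  none of which vanishes.
\<close>

lemma winding_number_cmult_loop:
  assumes "path \<gamma>" "pathfinish \<gamma> = pathstart \<gamma>" "0 \<notin> path_image \<gamma>" "u \<noteq> 0"
  shows "winding_number (\<lambda>x. u * \<gamma> x) 0 = winding_number \<gamma> 0"
proof -
  have "homotopic_loops (-{0}) \<gamma> (\<lambda>x. u * \<gamma> x)"
    unfolding homotopic_loops
  proof (intro exI[of _ "\<lambda>y. exp (of_real (fst y) * Ln u) * \<gamma> (snd y)"] conjI ballI)
    show "continuous_on ({0..1} \<times> {0..1}) (\<lambda>y. exp (of_real (fst y) * Ln u) * \<gamma> (snd y))"
      using assms(1) unfolding path_def
      by (auto intro!: continuous_intros intro: continuous_on_compose2 [where g = \<gamma>])
    show "(\<lambda>y. exp (of_real (fst y) * Ln u) * \<gamma> (snd y)) \<in> {0..1} \<times> {0..1} \<rightarrow> - {0}"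
      using assms(3) by (auto simp: path_image_def)
  qed (use assms in \<open>auto simp: pathfinish_def pathstart_def\<close>)
  then show ?thesis
    using winding_number_homotopic_loops by metis
qed

text \<open>
  Vectors with a positive inner product are never opposite, so the straight homotopy between the
  two loops avoids the origin. Unlike a closeness assumption this is insensitive to the lengths of
  the vectors, which allows a comparison of the normalized field with an unnormalized model.
\<close>

lemma winding_number_eq_if_inner_pos:
  assumes "path g" "path h" "pathfinish g = pathstart g" "pathfinish h = pathstart h"
    and pos: "\<And>x. x \<in> {0..1} \<Longrightarrow> g x \<bullet> h x > 0"
  shows "winding_number g 0 = winding_number h 0"
proof (rule winding_number_homotopic_loops, rule homotopic_loops_linear)
  fix x :: real
  assume x: "x \<in> {0..1}"
  have "(1 - a) *\<^sub>R g x + a *\<^sub>R h x \<noteq> 0" if "0 \<le> a" "a \<le> 1" for a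
  proof
    assume "(1 - a) *\<^sub>R g x + a *\<^sub>R h x = 0"
    then have "((1 - a) *\<^sub>R g x + a *\<^sub>R h x) \<bullet> h x = 0"
      by simp
    then have 0: "(1 - a) * (g x \<bullet> h x) + a * (h x \<bullet> h x) = 0"
      by (simp add: inner_add_left)
    moreover have "h x \<bullet> h x > 0"
      using pos[OF x] by auto
    ultimately show False
      using pos[OF x] that
      by (metis add_nonneg_eq_0_iff diff_ge_0_iff_ge less_eq_real_def mult_eq_0_iff
          mult_nonneg_nonneg order_less_irrefl right_minus_eq zero_neq_one)
  qed
  then show "closed_segment (g x) (h x) \<subseteq> - {0}"
    by (auto simp: closed_segment_def)
qed (use assms in auto)

section \<open>The index of a nondegenerate critical point\<close>

lemma inner_mult_cancel_left_complex: "(u * a) \<bullet> (u * b) = (norm u)\<^sup>2 * (a \<bullet> b)" for u a b :: complex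
  unfolding cmod_power2 inner_complex_def by (simp add: power2_eq_square algebra_simps)

text \<open>
  Near a nondegenerate zero the field \<open>V\<close> makes an acute angle with the model obtained from its
  derivative by putting \<open>sgn c\<close> in place of \<open>c\<close>. For the linear part the inner product is
  \<open>|u|\<^sup>2 (|c| x\<^sup>2 + y\<^sup>2)\<close> in terms of \<open>v = x + \<i>y\<close>, which grows like \<open>|v|\<^sup>2\<close>, and the
  remainder contributes only \<open>o(|v|\<^sup>2)\<close>.
\<close>

lemma nondegenerate_zero_inner_pos:
  assumes der: "(V has_derivative (\<lambda>v. u * Complex (c * Re v) (Im v))) (at p)"
    and "V p = 0" "u \<noteq> 0" "c \<noteq> 0"
  shows "\<exists>\<epsilon>>0. \<forall>z. z \<noteq> p \<and> dist z p < \<epsilon> \<longrightarrow>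
           V z \<bullet> (u * Complex (sgn c * Re (z - p)) (Im (z - p))) > 0"
proof -
  define m where "m = min \<bar>c\<bar> 1"
  have m: "m > 0" "m \<le> 1" "m \<le> \<bar>c\<bar>"
    using assms by (auto simp: m_def)
  \<comment> \<open>With this bound for the remainder its inner product with the model is at most half of the
    lower bound \<open>|u|\<^sup>2 m |v|\<^sup>2\<close> for the linear part.\<close>
  have "m * norm u / 2 > 0"
    using m assms by simp
  then obtain d where d: "d > 0"
      "\<And>z. norm (z - p) < d \<Longrightarrow>
         norm (V z - V p - u * Complex (c * Re (z - p)) (Im (z - p))) \<le> m * norm u / 2 * norm (z - p)"
    using der unfolding has_derivative_at_alt by blast
  show ?thesis
  proof (intro exI[of _ d] conjI allI impI)
    fix z
    assume z: "z \<noteq> p \<and> dist z p < d"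
    define v where "v = z - p"
    define D where "D = u * Complex (c * Re v) (Im v)"
    define S where "S = u * Complex (sgn c * Re v) (Im v)"
    have v: "norm v > 0"
      using z by (auto simp: v_def)
    have "norm (V z - D) \<le> m * norm u / 2 * norm v"
      using d(2)[of z] z assms(2) by (simp add: dist_norm v_def D_def)
    moreover have norm_S: "norm S = norm u * norm v"
      unfolding S_def norm_mult using \<open>c \<noteq> 0\<close> by (simp add: cmod_def power_mult_distrib sgn_if)
    ultimately have R: "\<bar>(V z - D) \<bullet> S\<bar> \<le> m * norm u / 2 * norm v * (norm u * norm v)"
      by (metis Cauchy_Schwarz_ineq2 mult_right_mono norm_ge_zero order_trans)
    have "m * (norm v)\<^sup>2 \<le> \<bar>c\<bar> * (Re v)\<^sup>2 + (Im v)\<^sup>2"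
      unfolding cmod_power2 distrib_left
      using m by (intro add_mono mult_right_mono mult_left_le_one_le) auto
    also have "\<dots> = Complex (c * Re v) (Im v) \<bullet> Complex (sgn c * Re v) (Im v)"
      by (simp add: inner_complex_def power2_eq_square abs_sgn)
    finally have "(norm u)\<^sup>2 * (m * (norm v)\<^sup>2) \<le> D \<bullet> S"
      by (simp add: D_def S_def inner_mult_cancel_left_complex mult_left_mono)
    moreover have "V z \<bullet> S = D \<bullet> S + (V z - D) \<bullet> S"
      by (simp add: inner_diff_left)
    moreover have "(norm u)\<^sup>2 * (m * (norm v)\<^sup>2) > 0"
      using m v assms by simp
    moreover have "m * norm u / 2 * norm v * (norm u * norm v) = (norm u)\<^sup>2 * (m * (norm v)\<^sup>2) / 2"
      by (simp add: power2_eq_square)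
    ultimately have "V z \<bullet> S > 0"
      using R by linarith
    then show "V z \<bullet> (u * Complex (sgn c * Re (z - p)) (Im (z - p))) > 0"
      by (simp add: S_def v_def)
  qed (use d in auto)
qed

text \<open>
  The model field of the previous lemma is, up to the constant factor \<open>\<plusminus>u\<close>, the map \<open>z - p\<close> for
  \<open>c > 0\<close> and its complex conjugate for \<open>c < 0\<close>. Along a positive loop around \<open>p\<close> these wind
  \<open>1\<close> and \<open>-1\<close> times about the origin.
\<close>

lemma has_poincare_index_nondegenerate:
  assumes der: "(V has_derivative (\<lambda>v. u * Complex (c * Re v) (Im v))) (at p)"
    and "V p = 0" "u \<noteq> 0" "c \<noteq> 0" and cont: "continuous_on UNIV V"
  shows "has_poincare_index V p (if c > 0 then 1 else -1)"
proof -
  obtain \<epsilon> where "\<epsilon> > 0"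
    and pos: "\<And>z. z \<noteq> p \<Longrightarrow> dist z p < \<epsilon> \<Longrightarrow>
           V z \<bullet> (u * Complex (sgn c * Re (z - p)) (Im (z - p))) > 0"
    using nondegenerate_zero_inner_pos[OF assms(1-4)] by blast
  have nz: "V z \<noteq> 0" if "z \<noteq> p" "dist z p < \<epsilon>" for z
    using pos[OF that] by auto
  have "isolated_critical_point V p"
    unfolding isolated_critical_point_def eventually_at
    using nz \<open>\<epsilon> > 0\<close> \<open>V p = 0\<close> by blast
  moreover have "winding_number (\<lambda>x. V (\<gamma> x) /\<^sub>R norm (V (\<gamma> x))) 0 = of_int (if c > 0 then 1 else -1)"
    if loop: "positive_simple_loop \<gamma>" and ball: "path_image \<gamma> \<subseteq> ball p \<epsilon>"
      and inside: "p \<in> inside (path_image \<gamma>)" for \<gamma>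
  proof -
    define S where "S x = u * Complex (sgn c * Re (\<gamma> x - p)) (Im (\<gamma> x - p))" for x
    define \<delta> where "\<delta> = (\<lambda>x. \<gamma> x - p)"
    have "path \<gamma>" and fin: "pathfinish \<gamma> = pathstart \<gamma>" and "winding_number \<gamma> p = 1"
      using loop inside by (auto simp: positive_simple_loop_def simple_path_imp_path)
    then have path: "continuous_on {0..1} \<gamma>"
      by (simp add: path_def)
    have "p \<notin> path_image \<gamma>"
      using inside inside_no_overlap by blast
    then have \<gamma>: "\<gamma> x \<noteq> p" "dist (\<gamma> x) p < \<epsilon>" if "x \<in> {0..1}" for x
      using ball that by (auto simp: path_image_def dist_commute image_subset_iff)
    have \<delta>: "path \<delta>" "pathfinish \<delta> = pathstart \<delta>" "0 \<notin> path_image \<delta>" "winding_number \<delta> 0 = 1"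
      using path fin \<gamma> \<open>winding_number \<gamma> p = 1\<close>
      by (auto simp: \<delta>_def path_def pathfinish_def pathstart_def path_image_def
          winding_number_offset[of \<gamma> p] intro!: continuous_intros)
    have "winding_number (\<lambda>x. V (\<gamma> x) /\<^sub>R norm (V (\<gamma> x))) 0 = winding_number S 0"
    proof (rule winding_number_eq_if_inner_pos)
      have "continuous_on {0..1} (\<lambda>x. V (\<gamma> x))"
        using continuous_on_compose2[OF cont path] by auto
      then show "path (\<lambda>x. V (\<gamma> x) /\<^sub>R norm (V (\<gamma> x)))"
        using nz \<gamma> by (auto simp: path_def intro!: continuous_intros)
      show "path S"
        unfolding S_def path_def Complex_eq by (intro continuous_intros path)
      show "(V (\<gamma> x) /\<^sub>R norm (V (\<gamma> x))) \<bullet> S x > 0" if "x \<in> {0..1}" for x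
        using pos[OF \<gamma>[OF that]] nz[OF \<gamma>[OF that]] by (simp add: S_def)
    qed (use fin in \<open>auto simp: S_def pathfinish_def pathstart_def\<close>)
    also have "\<dots> = of_int (if c > 0 then 1 else -1)"
    proof (cases "c > 0")
      case True
      then have "S = (\<lambda>x. u * \<delta> x)"
        by (auto simp: S_def \<delta>_def fun_eq_iff complex_eq_iff)
      then show ?thesis
        using True winding_number_cmult_loop[OF \<delta>(1-3) \<open>u \<noteq> 0\<close>] \<delta>(4) by simp
    next
      case False
      have "S = (\<lambda>x. (- u) * (cnj \<circ> \<delta>) x)"
        using False \<open>c \<noteq> 0\<close>
        by (auto simp: S_def \<delta>_def fun_eq_iff complex_eq_iff algebra_simps)
      moreover have "winding_number (cnj \<circ> \<delta>) 0 = -1"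
        using winding_number_cnj[OF \<delta>(1,3)] \<delta>(4) by simp
      moreover have "path (cnj \<circ> \<delta>)" "pathfinish (cnj \<circ> \<delta>) = pathstart (cnj \<circ> \<delta>)"
          "0 \<notin> path_image (cnj \<circ> \<delta>)"
        using \<delta> by (auto simp: path_image_compose pathfinish_compose pathstart_compose
            intro!: path_continuous_image continuous_intros)
      ultimately show ?thesis
        using False winding_number_cmult_loop[of "cnj \<circ> \<delta>" "- u"] \<open>u \<noteq> 0\<close> by simp
    qed
    finally show ?thesis .
  qed
  ultimately show ?thesis
    using \<open>\<epsilon> > 0\<close> unfolding has_poincare_index_def by blast
qed

lemma positive_simple_loop_circlepath:
  assumes "r > 0"
  shows "positive_simple_loop (circlepath p r)" "inside (path_image (circlepath p r)) = ball p r"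
proof -
  show *: "inside (path_image (circlepath p r)) = ball p r"
    using inside_frontier_eq_interior[of "cball p r"] assms by simp
  show "positive_simple_loop (circlepath p r)"
    unfolding positive_simple_loop_def *
    using assms winding_number_circlepath[of _ p r]
    by (auto simp: simple_path_circlepath dist_norm norm_minus_commute)
qed

text \<open>
  Two candidates for the index are compared along one circle that is small enough for both; it is
  here that a test loop has to be exhibited.
\<close>

lemma has_poincare_index_unique:
  assumes "has_poincare_index V p i" "has_poincare_index V p j"
  shows "i = j"
proof -
  define small where "small k \<epsilon> \<longleftrightarrow> \<epsilon> > 0 \<and> (\<forall>\<gamma>. positive_simple_loop \<gamma> \<and> path_image \<gamma> \<subseteq> ball p \<epsilon> \<and>
        p \<in> inside (path_image \<gamma>) \<and>
        (\<forall>z \<in> path_image \<gamma> \<union> inside (path_image \<gamma>). V z = 0 \<longrightarrow> z = p) \<longrightarrow>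
        winding_number (\<lambda>x. V (\<gamma> x) /\<^sub>R norm (V (\<gamma> x))) 0 = of_int k)" for k \<epsilon>
  obtain a b where a: "small i a" and b: "small j b"
    using assms unfolding has_poincare_index_def small_def by blast
  obtain d where "d > 0" and d: "\<And>z. z \<noteq> p \<Longrightarrow> dist z p < d \<Longrightarrow> V z \<noteq> 0"
    using assms(1) unfolding has_poincare_index_def isolated_critical_point_def eventually_at
    by blast
  define r where "r = min d (min a b) / 2"
  define \<gamma> where "\<gamma> = circlepath p r"
  have r: "r > 0" "r < d" "r < a" "r < b"
    using \<open>d > 0\<close> a b by (auto simp: r_def small_def)
  note circle = positive_simple_loop_circlepath[OF r(1), of p, folded \<gamma>_def]
  have image: "path_image \<gamma> = sphere p r"
    using r by (simp add: \<gamma>_def)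
  have "\<forall>z \<in> path_image \<gamma> \<union> inside (path_image \<gamma>). V z = 0 \<longrightarrow> z = p"
  proof (intro ballI impI)
    fix z
    assume "z \<in> path_image \<gamma> \<union> inside (path_image \<gamma>)" "V z = 0"
    moreover from this have "dist z p < d"
      using r unfolding circle(2) by (auto simp: image dist_commute)
    ultimately show "z = p"
      using d by blast
  qed
  moreover have "path_image \<gamma> \<subseteq> ball p a" "path_image \<gamma> \<subseteq> ball p b" "p \<in> inside (path_image \<gamma>)"
    using r unfolding circle(2) by (auto simp: image)
  ultimately have "of_int i = (of_int j :: complex)"
    using a b circle(1) unfolding small_def by metis
  then show ?thesis
    by simp
qed

lemma poincare_index_eqI: "has_poincare_index V p i \<Longrightarrow> poincare_index V p = i"
  unfolding poincare_index_def using has_poincare_index_unique by blast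

section \<open>Signed count of simple zeros\<close>

text \<open>
  At points where \<open>h\<close> vanishes with derivative \<open>h' \<noteq> 0\<close> this is the sign that \<open>h\<close> has
  immediately to the left; elsewhere it is the sign of \<open>h\<close>, which is the same on both sides. With
  this convention zeros at the ends of an interval require no exception.
\<close>

definition left_sign :: "(real \<Rightarrow> real) \<Rightarrow> (real \<Rightarrow> real) \<Rightarrow> real \<Rightarrow> real" where
  "left_sign h h' x = (if h x = 0 then - sgn (h' x) else sgn (h x))"

lemma signs_near_simple_zero:
  fixes h :: "real \<Rightarrow> real"
  assumes "(h has_real_derivative D) (at x)" "h x = 0" "D \<noteq> 0"
  shows "\<exists>d>0. \<forall>y. \<bar>y - x\<bar> < d \<longrightarrow> sgn (h y) = sgn D * sgn (y - x)"
proof -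
  have "((\<lambda>y. (h y - h x) / (y - x) * sgn D) \<longlongrightarrow> D * sgn D) (at x)"
    using assms(1) unfolding has_field_derivative_iff by (intro tendsto_intros)
  moreover have "D * sgn D > 0"
    using assms by (simp add: sgn_if)
  ultimately have "\<forall>\<^sub>F y in at x. (h y - h x) / (y - x) * sgn D > 0"
    by (simp add: order_tendstoD(1))
  then obtain d where "d > 0"
    and d: "\<And>y. y \<noteq> x \<Longrightarrow> dist y x < d \<Longrightarrow> h y / (y - x) * sgn D > 0"
    unfolding eventually_at using assms by auto
  have "sgn (h y) = sgn D * sgn (y - x)" if "\<bar>y - x\<bar> < d" for y
  proof (cases "y = x")
    case False
    then show ?thesis
      using d[of y] that assms
      by (auto simp: dist_real_def sgn_if zero_less_mult_iff zero_less_divide_iff split: if_splits)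
  qed (use assms in auto)
  then show ?thesis
    using \<open>d > 0\<close> by blast
qed

text \<open>
  Both sides are additive when half-open intervals are joined, so by bisection it suffices to
  look at short intervals containing a given point \<open>x\<close>. There \<open>h\<close> either has constant sign or
  vanishes at \<open>x\<close> only, where its sign jumps from \<open>- sgn (h' x)\<close> to \<open>sgn (h' x)\<close>. The same argument
  gives finiteness.
\<close>

lemma sum_sgn_simple_zeros:
  fixes h h' :: "real \<Rightarrow> real"
  assumes der: "\<And>x. (h has_real_derivative h' x) (at x)"
    and simple: "\<And>x. h x = 0 \<Longrightarrow> h' x \<noteq> 0"
    and "a \<le> b"
  shows "finite {x \<in> {a..<b}. h x = 0} \<and>
         2 * (\<Sum>x \<in> {x \<in> {a..<b}. h x = 0}. sgn (h' x)) = left_sign h h' b - left_sign h h' a"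
    (is "?P a b")
  using \<open>a \<le> b\<close>
proof (induction rule: Bolzano)
  case (trans a b c)
  have "{x \<in> {a..<c}. h x = 0} = {x \<in> {a..<b}. h x = 0} \<union> {x \<in> {b..<c}. h x = 0}"
    using trans by auto
  moreover have "{x \<in> {a..<b}. h x = 0} \<inter> {x \<in> {b..<c}. h x = 0} = {}"
    by auto
  ultimately show ?case
    using trans by (simp add: sum.union_disjoint)
next
  case (local x)
  show ?case
  proof (cases "h x = 0")
    case True
    then obtain d where "d > 0" and d: "\<And>y. \<bar>y - x\<bar> < d \<Longrightarrow> sgn (h y) = sgn (h' x) * sgn (y - x)"
      using signs_near_simple_zero[OF der[of x]] simple by blast
    have "?P a b" if ab: "a \<le> x \<and> x \<le> b \<and> b - a < d" for a b
    proof -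
      have zeros: "h y = 0 \<longleftrightarrow> y = x" if "y \<in> {a..b}" for y
      proof -
        have "\<bar>y - x\<bar> < d"
          using that ab by auto
        then show ?thesis
          using d[of y] simple[OF True] True by (auto simp: sgn_0_0)
      qed
      then have "{y \<in> {a..<b}. h y = 0} = (if x < b then {x} else {})"
        using ab by auto
      moreover have "left_sign h h' a = - sgn (h' x)"
        using d[of a] ab zeros[of a] by (auto simp: left_sign_def)
      moreover have "left_sign h h' b = (if x < b then sgn (h' x) else - sgn (h' x))"
        using d[of b] ab zeros[of b] by (auto simp: left_sign_def)
      ultimately show ?thesis
        by simp
    qed
    then show ?thesis
      using \<open>d > 0\<close> by blast
  next
    case False
    have "((\<lambda>y. h y * sgn (h x)) \<longlongrightarrow> h x * sgn (h x)) (at x)"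
      using DERIV_isCont[OF der[of x]] unfolding isCont_def by (intro tendsto_intros)
    moreover have "h x * sgn (h x) > 0"
      using False by (simp add: sgn_if)
    ultimately have "\<forall>\<^sub>F y in at x. h y * sgn (h x) > 0"
      by (simp add: order_tendstoD(1))
    then obtain d where "d > 0" and d: "\<And>y. y \<noteq> x \<Longrightarrow> dist y x < d \<Longrightarrow> h y * sgn (h x) > 0"
      unfolding eventually_at by auto
    have "?P a b" if ab: "a \<le> x \<and> x \<le> b \<and> b - a < d" for a b
    proof -
      have sgn: "sgn (h y) = sgn (h x)" if "y \<in> {a..b}" for y
      proof (cases "y = x")
        case False
        moreover have "dist y x < d"
          using that ab by (auto simp: dist_real_def)
        ultimately show ?thesis
          using d[of y] \<open>h x \<noteq> 0\<close> by (auto simp: sgn_if zero_less_mult_iff split: if_splits)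
      qed simp
      then have "h y \<noteq> 0" if "y \<in> {a..b}" for y
        using that False by (metis sgn_0_0)
      then have none: "{y \<in> {a..<b}. h y = 0} = {}" and "h a \<noteq> 0" "h b \<noteq> 0"
        using ab by auto
      then show ?thesis
        unfolding none using sgn[of a] sgn[of b] ab by (simp add: left_sign_def)
    qed
    then show ?thesis
      using \<open>d > 0\<close> by blast
  qed
qed

section \<open>The moving frame and the normal map\<close>

lemma has_vector_derivative_unit_tangent:
  assumes "closed_arclength_curve l \<alpha>"
  shows "(\<alpha> has_vector_derivative unit_tangent \<alpha> s) (at s)"
proof -
  have "((\<lambda>f s. vector_derivative f (at s)) ^^ 0) \<alpha> differentiable at s"
    using assms unfolding closed_arclength_curve_def smooth_curve_def by blast
  then show ?thesis
    by (simp add: unit_tangent_def vector_derivative_works)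
qed

lemma norm_unit_tangent:
  assumes "closed_arclength_curve l \<alpha>"
  shows "norm (unit_tangent \<alpha> s) = 1"
  using assms by (simp add: closed_arclength_curve_def unit_tangent_def)

text \<open>
  The tangent has constant length, so its derivative is orthogonal to it and therefore a real
  multiple of the normal. This shows that the description defining the curvature has a solution;
  uniqueness holds because the normal is not zero.
\<close>

lemma frenet_unit_tangent:
  assumes \<alpha>: "closed_arclength_curve l \<alpha>"
  shows "(unit_tangent \<alpha> has_vector_derivative curvature \<alpha> s *\<^sub>R unit_normal \<alpha> s) (at s)"
proof -
  define t where "t = unit_tangent \<alpha>"
  define t' where "t' = vector_derivative t (at s)"
  have "((\<lambda>f s. vector_derivative f (at s)) ^^ 1) \<alpha> differentiable at s"
    using \<alpha> unfolding closed_arclength_curve_def smooth_curve_def by blast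
  then have "t differentiable at s"
    by (simp add: t_def unit_tangent_def [abs_def])
  then have t': "(t has_vector_derivative t') (at s)"
    by (simp add: t'_def vector_derivative_works)
  have unit: "t s \<bullet> t s = 1" for s
    using norm_unit_tangent[OF \<alpha>] by (simp add: t_def dot_square_norm)
  have "((\<lambda>s. t s \<bullet> t s) has_vector_derivative t s \<bullet> t' + t' \<bullet> t s) (at s)"
    by (rule bounded_bilinear.has_vector_derivative[OF bounded_bilinear_inner t' t'])
  moreover have "((\<lambda>s. t s \<bullet> t s) has_vector_derivative 0) (at s)"
    by (simp add: unit)
  ultimately have "t s \<bullet> t' + t' \<bullet> t s = 0"
    using vector_derivative_unique_at by blast
  then have "t s \<bullet> t' = 0"
    by (simp add: inner_commute)
  define k where "k = t' \<bullet> (\<i> * t s)"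
  have "(Re (t s))\<^sup>2 + (Im (t s))\<^sup>2 = 1" "Re (t s) * Re t' + Im (t s) * Im t' = 0"
    using unit[of s] \<open>t s \<bullet> t' = 0\<close> by (simp_all add: inner_complex_def power2_eq_square)
  then have "Re t' = - k * Im (t s)" "Im t' = k * Re (t s)"
    unfolding k_def inner_complex_def by (simp; algebra)+
  then have "t' = k *\<^sub>R (\<i> * t s)"
    by (simp add: complex_eq_iff)
  moreover have "curvature \<alpha> s = k"
    unfolding curvature_def
  proof (rule the_equality)
    have "\<i> * t s \<noteq> 0"
      using unit[of s] by auto
    then show "k' = k"
      if "vector_derivative (unit_tangent \<alpha>) (at s) = k' *\<^sub>R unit_normal \<alpha> s" for k'
      using that calculation by (simp add: t'_def t_def unit_normal_def)
  qed (use calculation in \<open>simp add: t'_def t_def unit_normal_def\<close>)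
  ultimately show ?thesis
    using t' by (simp add: t_def unit_normal_def)
qed

lemma has_vector_derivative_unit_normal:
  assumes "closed_arclength_curve l \<alpha>"
  shows "(unit_normal \<alpha> has_vector_derivative - curvature \<alpha> s *\<^sub>R unit_tangent \<alpha> s) (at s)"
proof -
  have "((\<lambda>s. \<i> * unit_tangent \<alpha> s) has_vector_derivative
          \<i> * (curvature \<alpha> s *\<^sub>R unit_normal \<alpha> s)) (at s)"
    by (intro has_vector_derivative_mult_right frenet_unit_tangent[OF assms])
  moreover have "\<i> * (curvature \<alpha> s *\<^sub>R unit_normal \<alpha> s) = - curvature \<alpha> s *\<^sub>R unit_tangent \<alpha> s"
    by (simp add: unit_normal_def complex_eq_iff)
  ultimately show ?thesis
    by (simp add: unit_normal_def [abs_def])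
qed

lemma normal_field_has_derivative:
  assumes "closed_arclength_curve l \<alpha>"
  shows "(normal_field \<alpha> has_derivative
           (\<lambda>v. unit_tangent \<alpha> (Re p) *
              Complex ((1 - Im p * curvature \<alpha> (Re p)) * Re v) (Im v))) (at p)"
proof -
  define t n k where "t = unit_tangent \<alpha> (Re p)" and "n = unit_normal \<alpha> (Re p)"
    and "k = curvature \<alpha> (Re p)"
  have Re: "(Re has_derivative Re) (at p)"
    by (rule bounded_linear_imp_has_derivative[OF bounded_linear_Re])
  have "((\<lambda>z. \<alpha> (Re z)) has_derivative (\<lambda>v. Re v *\<^sub>R t)) (at p)"
    using has_derivative_compose[OF Re
        has_vector_derivative_unit_tangent[OF assms, unfolded has_vector_derivative_def]]
    by (simp add: t_def)
  moreover have "((\<lambda>z. unit_normal \<alpha> (Re z)) has_derivative (\<lambda>v. Re v *\<^sub>R (- k *\<^sub>R t))) (at p)"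
    using has_derivative_compose[OF Re
        has_vector_derivative_unit_normal[OF assms, unfolded has_vector_derivative_def]]
    by (simp add: t_def k_def)
  ultimately have "((\<lambda>z. \<alpha> (Re z) + Im z *\<^sub>R unit_normal \<alpha> (Re z)) has_derivative
      (\<lambda>v. Re v *\<^sub>R t + (Im p *\<^sub>R (Re v *\<^sub>R (- k *\<^sub>R t)) + Im v *\<^sub>R n))) (at p)"
    unfolding n_def
    by (intro has_derivative_add has_derivative_scaleR
        bounded_linear_imp_has_derivative[OF bounded_linear_Im])
  moreover have "normal_field \<alpha> = (\<lambda>z. \<alpha> (Re z) + Im z *\<^sub>R unit_normal \<alpha> (Re z))"
    by (simp add: normal_field_def [abs_def] normal_map_def)
  moreover have "(\<lambda>v. Re v *\<^sub>R t + (Im p *\<^sub>R (Re v *\<^sub>R (- k *\<^sub>R t)) + Im v *\<^sub>R n)) =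
      (\<lambda>v. t * Complex ((1 - Im p * k) * Re v) (Im v))"
    by (auto simp: n_def unit_normal_def t_def complex_eq_iff algebra_simps)
  ultimately show ?thesis
    by (simp add: t_def k_def)
qed

definition tangential_part :: "(real \<Rightarrow> complex) \<Rightarrow> real \<Rightarrow> real" where
  "tangential_part \<alpha> s = \<alpha> s \<bullet> unit_tangent \<alpha> s"

text \<open>
  In the orthonormal frame \<open>(t, n)\<close> the normal map has the components \<open>\<alpha> \<bullet> t\<close> and
  \<open>\<alpha> \<bullet> n + \<rho>\<close>.
\<close>

lemma normal_map_eq_0_iff:
  assumes "closed_arclength_curve l \<alpha>"
  shows "normal_map \<alpha> (s, \<rho>) = 0 \<longleftrightarrow>
           tangential_part \<alpha> s = 0 \<and> \<rho> = - (\<alpha> s \<bullet> unit_normal \<alpha> s)"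
proof -
  define t where "t = unit_tangent \<alpha> s"
  have "t \<bullet> t = 1"
    using norm_unit_tangent[OF assms] by (simp add: t_def dot_square_norm)
  then have t: "(Re t)\<^sup>2 + (Im t)\<^sup>2 = 1"
    by (simp add: inner_complex_def power2_eq_square)
  define x y where "x = Re (\<alpha> s)" and "y = Im (\<alpha> s)"
  have "x - \<rho> * Im t = 0 \<and> y + \<rho> * Re t = 0 \<longleftrightarrow>
      x * Re t + y * Im t = 0 \<and> \<rho> = - (- x * Im t + y * Re t)"
    using t by algebra
  then show ?thesis
    by (simp add: normal_map_def tangential_part_def unit_normal_def inner_complex_def
        complex_eq_iff x_def y_def t_def)
qed

lemma tangential_part_has_derivative:
  assumes "closed_arclength_curve l \<alpha>"
  shows "(tangential_part \<alpha> has_real_derivative 1 + curvature \<alpha> s * (\<alpha> s \<bullet> unit_normal \<alpha> s)) (at s)"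
proof -
  have "((\<lambda>s. \<alpha> s \<bullet> unit_tangent \<alpha> s) has_vector_derivative
      \<alpha> s \<bullet> (curvature \<alpha> s *\<^sub>R unit_normal \<alpha> s) + unit_tangent \<alpha> s \<bullet> unit_tangent \<alpha> s) (at s)"
    by (rule bounded_bilinear.has_vector_derivative[OF bounded_bilinear_inner
          has_vector_derivative_unit_tangent[OF assms] frenet_unit_tangent[OF assms]])
  then show ?thesis
    using norm_unit_tangent[OF assms]
    by (simp add: has_real_derivative_iff_has_vector_derivative tangential_part_def [abs_def]
        dot_square_norm add.commute)
qed

lemma periodic_frame:
  assumes "closed_arclength_curve l \<alpha>"
  shows "\<alpha> (s + l) = \<alpha> s" "unit_tangent \<alpha> (s + l) = unit_tangent \<alpha> s"
    "unit_normal \<alpha> (s + l) = unit_normal \<alpha> s" "curvature \<alpha> (s + l) = curvature \<alpha> s"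
proof -
  have shift: "vector_derivative f (at (s + l)) = vector_derivative f (at s)"
    if "(f has_vector_derivative D) (at (s + l))" "\<And>s. f (s + l) = f s"
    for f :: "real \<Rightarrow> complex" and D s
  proof -
    have "((\<lambda>s. f (s + l)) has_vector_derivative D) (at s)"
      using vector_diff_chain_at[of "\<lambda>s. s + l" 1 s f D] that(1)
      by (simp add: o_def has_vector_derivative_add_const)
    then show ?thesis
      using that by (simp add: vector_derivative_at)
  qed
  show \<alpha>: "\<alpha> (s + l) = \<alpha> s" for s
    using assms by (simp add: closed_arclength_curve_def)
  show t: "unit_tangent \<alpha> (s + l) = unit_tangent \<alpha> s" for s
    unfolding unit_tangent_def by (rule shift[OF has_vector_derivative_unit_tangent[OF assms] \<alpha>])
  show n: "unit_normal \<alpha> (s + l) = unit_normal \<alpha> s" for s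
    by (simp add: unit_normal_def t)
  show "curvature \<alpha> (s + l) = curvature \<alpha> s"
    unfolding curvature_def n shift[OF frenet_unit_tangent[OF assms] t] ..
qed

text \<open>
  A point where the distance from the origin to the curve is critical is a zero of the tangential
  part; the derivative of \<open>|\<alpha>|\<^sup>2\<close> is twice that part.
\<close>

lemma exists_tangential_part_zero:
  assumes "closed_arclength_curve l \<alpha>"
  shows "\<exists>s\<in>{0..<l}. tangential_part \<alpha> s = 0"
proof -
  have der: "((\<lambda>s. \<alpha> s \<bullet> \<alpha> s) has_real_derivative 2 * tangential_part \<alpha> s) (at s)" for s
    using bounded_bilinear.has_vector_derivative[OF bounded_bilinear_inner
        has_vector_derivative_unit_tangent[OF assms] has_vector_derivative_unit_tangent[OF assms], of s]
    by (simp add: has_real_derivative_iff_has_vector_derivative tangential_part_def inner_commute)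
  have "0 < l" "\<alpha> l = \<alpha> 0"
    using assms periodic_frame(1)[OF assms, of 0] by (auto simp: closed_arclength_curve_def)
  then obtain s where s: "0 < s" "s < l" "((\<lambda>s. \<alpha> s \<bullet> \<alpha> s) has_real_derivative 0) (at s)"
    using Rolle[of 0 l "\<lambda>s. \<alpha> s \<bullet> \<alpha> s"] DERIV_continuous_on[of "{0..l}", OF DERIV_subset[OF der]]
      der real_differentiable_def by (metis top_greatest)
  then show ?thesis
    using DERIV_unique[OF der[of s]] by force
qed

section \<open>Centres and saddles\<close>

theorem theorem1:
  fixes \<alpha> :: "real \<Rightarrow> complex" and l :: real
  assumes "closed_arclength_curve l \<alpha>"
    and "\<forall>s. curvature \<alpha> s > 0"
    and "\<forall>s. evolute \<alpha> s \<noteq> 0"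
  shows "(\<forall>(s, \<rho>) \<in> critical_points l \<alpha>.
            has_poincare_index (normal_field \<alpha>) (Complex s \<rho>) 1 \<or>
            has_poincare_index (normal_field \<alpha>) (Complex s \<rho>) (-1)) \<and>
         (\<forall>(s, \<rho>) \<in> saddles l \<alpha>. \<rho> > 1 / curvature \<alpha> s) \<and>
         (\<forall>(s, \<rho>) \<in> centres l \<alpha>. \<rho> < 1 / curvature \<alpha> s) \<and>
         finite (critical_points l \<alpha>) \<and>
         card (saddles l \<alpha>) = card (centres l \<alpha>) \<and>
         (\<Sum>(s, \<rho>) \<in> critical_points l \<alpha>. poincare_index (normal_field \<alpha>) (Complex s \<rho>)) = 0 \<and>
         saddles l \<alpha> \<noteq> {} \<and> centres l \<alpha> \<noteq> {}"
proof -
  note \<alpha> = assms(1)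
  \<comment> \<open>The only candidate for a critical point over \<open>s\<close> has the height \<open>r s\<close>; the function \<open>h'\<close> is both
    the derivative of \<open>h\<close> and the Jacobian of the normal map at \<open>(s, r s)\<close>.\<close>
  define k h h' r where "k = curvature \<alpha>" and "h = tangential_part \<alpha>"
    and "h' s = 1 + k s * (\<alpha> s \<bullet> unit_normal \<alpha> s)"
    and "r s = - (\<alpha> s \<bullet> unit_normal \<alpha> s)" for s
  define Z where "Z = {s \<in> {0..<l}. h s = 0}"
  have k: "k s > 0" for s
    using assms(2) by (simp add: k_def)
  have h'_eq: "h' s = 1 - r s * k s" for s
    by (simp add: h'_def r_def)
  have zero_iff: "normal_map \<alpha> (s, \<rho>) = 0 \<longleftrightarrow> h s = 0 \<and> \<rho> = r s" for s \<rho>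
    using normal_map_eq_0_iff[OF \<alpha>] by (simp add: h_def r_def)
  have der: "(h has_real_derivative h' s) (at s)" for s
    using tangential_part_has_derivative[OF \<alpha>] by (simp add: h_def h'_def k_def)
  have simple: "h' s \<noteq> 0" if "h s = 0" for s
  proof
    assume "h' s = 0"
    then have "r s = 1 / k s"
      using k[of s] by (simp add: h'_eq field_simps)
    then have "evolute \<alpha> s = normal_map \<alpha> (s, r s)"
      by (simp add: evolute_def normal_map_def k_def)
    then show False
      using that zero_iff assms(3) by metis
  qed
  have crit: "critical_points l \<alpha> = (\<lambda>s. (s, r s)) ` Z"
    by (auto simp: critical_points_def zero_iff Z_def)
  have inj: "inj_on (\<lambda>s. (s, r s)) A" for A
    by (auto simp: inj_on_def)
  have cont: "continuous_on UNIV (normal_field \<alpha>)"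
    using normal_field_has_derivative[OF \<alpha>]
    by (meson continuous_at_imp_continuous_on has_derivative_continuous)
  have index: "has_poincare_index (normal_field \<alpha>) (Complex s (r s)) (if h' s > 0 then 1 else -1)"
    if "s \<in> Z" for s
  proof (rule has_poincare_index_nondegenerate[OF _ _ _ _ cont])
    show "(normal_field \<alpha> has_derivative
        (\<lambda>v. unit_tangent \<alpha> s * Complex (h' s * Re v) (Im v))) (at (Complex s (r s)))"
      using normal_field_has_derivative[OF \<alpha>, of "Complex s (r s)"] by (simp add: h'_eq k_def)
    show "normal_field \<alpha> (Complex s (r s)) = 0"
      using that by (simp add: normal_field_def zero_iff Z_def)
    show "unit_tangent \<alpha> s \<noteq> 0"
      using norm_unit_tangent[OF \<alpha>, of s] by auto
    show "h' s \<noteq> 0"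
      using that simple by (simp add: Z_def)
  qed
  have below_iff: "r s < 1 / k s \<longleftrightarrow> h' s > 0" and above_iff: "r s > 1 / k s \<longleftrightarrow> h' s < 0" for s
    using k[of s] by (simp_all add: h'_eq field_simps)
  have index_iff: "has_poincare_index (normal_field \<alpha>) (Complex s (r s)) i \<longleftrightarrow>
      i = (if h' s > 0 then 1 else -1)" if "s \<in> Z" for s i
    using index[OF that] has_poincare_index_unique by blast
  have centres: "centres l \<alpha> = (\<lambda>s. (s, r s)) ` {s \<in> Z. h' s > 0}"
    by (auto simp: centres_def crit index_iff image_iff split: if_splits)
  have nonpos_iff: "\<not> h' s > 0 \<longleftrightarrow> h' s < 0" if "s \<in> Z" for s
    using simple[of s] that by (simp add: Z_def) linarith
  have saddles: "saddles l \<alpha> = (\<lambda>s. (s, r s)) ` {s \<in> Z. h' s < 0}"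
    by (auto simp: saddles_def crit index_iff image_iff nonpos_iff[symmetric] split: if_splits)
  have "0 < l"
    using \<alpha> by (simp add: closed_arclength_curve_def)
  have "left_sign h h' l = left_sign h h' 0"
    using periodic_frame[OF \<alpha>, of 0]
    by (simp add: left_sign_def h_def tangential_part_def h'_def k_def)
  then have "finite Z" and sum: "(\<Sum>s\<in>Z. sgn (h' s)) = 0"
    using sum_sgn_simple_zeros[OF der simple, of 0 l] \<open>0 < l\<close> by (simp_all add: Z_def)
  have split: "Z = {s \<in> Z. h' s > 0} \<union> {s \<in> Z. h' s < 0}"
      "{s \<in> Z. h' s > 0} \<inter> {s \<in> Z. h' s < 0} = {}"
    using nonpos_iff by force+
  have "(\<Sum>s\<in>Z. sgn (h' s)) =
      real (card {s \<in> Z. h' s > 0}) - real (card {s \<in> Z. h' s < 0})"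
    using sum.union_disjoint[where g = "\<lambda>s. sgn (h' s)", OF _ _ split(2)] split(1) \<open>finite Z\<close>
    by auto
  then have card: "card {s \<in> Z. h' s < 0} = card {s \<in> Z. h' s > 0}"
    using sum by simp
  have "(\<Sum>(s, \<rho>) \<in> critical_points l \<alpha>. poincare_index (normal_field \<alpha>) (Complex s \<rho>)) =
      (\<Sum>s\<in>Z. if h' s > 0 then 1 else -1)"
    unfolding crit by (simp add: sum.reindex[OF inj] poincare_index_eqI[OF index])
  also have "real_of_int \<dots> = (\<Sum>s\<in>Z. sgn (h' s))"
    unfolding of_int_sum using simple by (intro sum.cong) (auto simp: Z_def sgn_if)
  finally have "(\<Sum>(s, \<rho>) \<in> critical_points l \<alpha>. poincare_index (normal_field \<alpha>) (Complex s \<rho>)) = 0"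
    using sum by (metis of_int_eq_0_iff)
  moreover have "Z \<noteq> {}"
    using exists_tangential_part_zero[OF \<alpha>] by (auto simp: Z_def h_def)
  then have "{s \<in> Z. h' s > 0} \<noteq> {}" "{s \<in> Z. h' s < 0} \<noteq> {}"
    using card split(1) \<open>finite Z\<close> by (metis (no_types, lifting) Un_empty card_0_eq finite_Un)+
  ultimately show ?thesis
    using below_iff above_iff \<open>finite Z\<close> card
    unfolding crit centres saddles k_def[symmetric]
    by (auto simp: card_image[OF inj] index_iff)
qed

end
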